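(* Let $G$ be an essentially principal étale groupoid whose unit space is a Cantor set. Suppose that $G^{(0)}$ is properly infinite. Then the group $[[G]]$ contains a subgroup isomorphic to the free product $\mathbb{Z}_2*\mathbb{Z}_3$. In particular, $[[G]]$ is not amenable.
   Context: $\mathbb{Z}_n$ is the finite cyclic group of order $n$; amenability is that of a discrete group. A Cantor set is a (non-empty) compact, metrizable, totally disconnected space with no isolated points. Clopen means closed and open. An étale groupoid is a second countable locally compact Hausdorff topological groupoid $G$ whose range map is a local homeomorphism. $G^{(0)}$ is the unit space, $s,r$ are the source and range maps, and $gh$ is defined when $s(g)=r(h)$. $G$ is essentially principal if the interior of $\{g\in G\mid r(g)=s(g)\}$ is $G^{(0)}$. A $G$-set is a subset $U\subset G$ such that $r|U$ and $s|U$ are injective; for an open $G$-set $U$, $\pi_U=r\circ(s|U)^{-1}:s(U)\to r(U)$ (a homeomorphism). When $G^{(0)}$ is compact, the topological full group $[[G]]$ is the group of all $\alpha\in\mathrm{Homeo}(G^{(0)})$ for which there is a compact open $G$-set $U$ with $\alpha=\pi_U$ (so $s(U)=r(U)=G^{(0)}$). A clopen set $A\subset G^{(0)}$ is properly infinite if there exist compact open $G$-sets $U,V\subset G$ such that $s(U)=s(V)=A$, $r(U)\cup r(V)\subset A$ and $r(U)\cap r(V)=\emptyset$. *)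

theory Defs
  imports "HOL-Analysis.Analysis" "HOL-Algebra.Bij" "HOL-Algebra.Coset" "HOL-Algebra.Elementary_Groups"
begin

section \<open>Topological notions\<close>

definition second_countable_space :: "'a topology \<Rightarrow> bool" where
  "second_countable_space X \<longleftrightarrow>
     (\<exists>\<B>. countable \<B> \<and> (\<forall>V\<in>\<B>. openin X V) \<and>
          (\<forall>U x. openin X U \<and> x \<in> U \<longrightarrow> (\<exists>V\<in>\<B>. x \<in> V \<and> V \<subseteq> U)))"

definition totally_disconnected_space :: "'a topology \<Rightarrow> bool" where
  "totally_disconnected_space X \<longleftrightarrow> (\<forall>S. connectedin X S \<longrightarrow> (\<exists>a. S \<subseteq> {a}))"

definition cantor_space :: "'a topology \<Rightarrow> bool" where
  "cantor_space X \<longleftrightarrow>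
     topspace X \<noteq> {} \<and> compact_space X \<and> metrizable_space X \<and>
     totally_disconnected_space X \<and> (\<forall>x\<in>topspace X. \<not> openin X {x})"

definition local_homeomorphism :: "'a topology \<Rightarrow> 'b topology \<Rightarrow> ('a \<Rightarrow> 'b) \<Rightarrow> bool" where
  "local_homeomorphism X Y f \<longleftrightarrow>
     (\<forall>x\<in>topspace X. \<exists>U. openin X U \<and> x \<in> U \<and> openin Y (f ` U) \<and>
        homeomorphic_map (subtopology X U) (subtopology Y (f ` U)) f)"


section \<open>Etale groupoids\<close>

text \<open>
  A groupoid is identified with its set of arrows, the topological space of all arrows being
  \<open>arrows G\<close>; objects are identified with their identity arrows.
  The product \<open>gmult G g h\<close> is only meaningful if \<open>src G g = rng G h\<close>.
\<close>

record 'a groupoid_data =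
  arrows :: "'a topology"
  src :: "'a \<Rightarrow> 'a"
  rng :: "'a \<Rightarrow> 'a"
  gmult :: "'a \<Rightarrow> 'a \<Rightarrow> 'a"
  ginv :: "'a \<Rightarrow> 'a"

abbreviation arrow_set :: "('a, 'm) groupoid_data_scheme \<Rightarrow> 'a set" where
  "arrow_set G \<equiv> topspace (arrows G)"

definition unit_space :: "('a, 'm) groupoid_data_scheme \<Rightarrow> 'a set" where
  "unit_space G = src G ` arrow_set G"

definition unit_topology :: "('a, 'm) groupoid_data_scheme \<Rightarrow> 'a topology" where
  "unit_topology G = subtopology (arrows G) (unit_space G)"

definition composable :: "('a, 'm) groupoid_data_scheme \<Rightarrow> ('a \<times> 'a) set" where
  "composable G = {(g, h). g \<in> arrow_set G \<and> h \<in> arrow_set G \<and> src G g = rng G h}"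

locale topological_groupoid =
  fixes G :: "('a, 'm) groupoid_data_scheme"
  assumes src_closed: "g \<in> arrow_set G \<Longrightarrow> src G g \<in> arrow_set G"
    and rng_closed: "g \<in> arrow_set G \<Longrightarrow> rng G g \<in> arrow_set G"
    and src_src: "g \<in> arrow_set G \<Longrightarrow> src G (src G g) = src G g"
    and rng_src: "g \<in> arrow_set G \<Longrightarrow> rng G (src G g) = src G g"
    and src_rng: "g \<in> arrow_set G \<Longrightarrow> src G (rng G g) = rng G g"
    and rng_rng: "g \<in> arrow_set G \<Longrightarrow> rng G (rng G g) = rng G g"
    and gmult_closed: "(g, h) \<in> composable G \<Longrightarrow> gmult G g h \<in> arrow_set G"
    and src_gmult: "(g, h) \<in> composable G \<Longrightarrow> src G (gmult G g h) = src G h"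
    and rng_gmult: "(g, h) \<in> composable G \<Longrightarrow> rng G (gmult G g h) = rng G g"
    and gmult_assoc: "(g, h) \<in> composable G \<Longrightarrow> (h, k) \<in> composable G \<Longrightarrow>
          gmult G (gmult G g h) k = gmult G g (gmult G h k)"
    and gmult_src: "g \<in> arrow_set G \<Longrightarrow> gmult G g (src G g) = g"
    and rng_gmult_left: "g \<in> arrow_set G \<Longrightarrow> gmult G (rng G g) g = g"
    and ginv_closed: "g \<in> arrow_set G \<Longrightarrow> ginv G g \<in> arrow_set G"
    and src_ginv: "g \<in> arrow_set G \<Longrightarrow> src G (ginv G g) = rng G g"
    and rng_ginv: "g \<in> arrow_set G \<Longrightarrow> rng G (ginv G g) = src G g"
    and ginv_gmult: "g \<in> arrow_set G \<Longrightarrow> gmult G (ginv G g) g = src G g"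
    and gmult_ginv: "g \<in> arrow_set G \<Longrightarrow> gmult G g (ginv G g) = rng G g"
    and continuous_gmult:
          "continuous_map (subtopology (prod_topology (arrows G) (arrows G)) (composable G))
             (arrows G) (\<lambda>(g, h). gmult G g h)"
    and continuous_ginv: "continuous_map (arrows G) (arrows G) (ginv G)"

locale etale_groupoid = topological_groupoid G
  for G :: "('a, 'm) groupoid_data_scheme" +
  assumes second_countable: "second_countable_space (arrows G)"
    and locally_compact: "locally_compact_space (arrows G)"
    and hausdorff: "Hausdorff_space (arrows G)"
    and rng_local_homeomorphism: "local_homeomorphism (arrows G) (unit_topology G) (rng G)"

definition essentially_principal :: "('a, 'm) groupoid_data_scheme \<Rightarrow> bool" where
  "essentially_principal G \<longleftrightarrow>
     arrows G interior_of {g \<in> arrow_set G. rng G g = src G g} = unit_space G"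

definition G_set :: "('a, 'm) groupoid_data_scheme \<Rightarrow> 'a set \<Rightarrow> bool" where
  "G_set G U \<longleftrightarrow> U \<subseteq> arrow_set G \<and> inj_on (rng G) U \<and> inj_on (src G) U"

definition compact_open_G_set :: "('a, 'm) groupoid_data_scheme \<Rightarrow> 'a set \<Rightarrow> bool" where
  "compact_open_G_set G U \<longleftrightarrow> G_set G U \<and> compactin (arrows G) U \<and> openin (arrows G) U"

text \<open>
  The map \<open>r \<circ> (s|U)\<^sup>-\<^sup>1 : s(U) \<rightarrow> r(U)\<close>, made extensional (\<open>undefined\<close> off \<open>s(U)\<close>) so that it can
  be an element of \<^const>\<open>BijGroup\<close>.
\<close>

definition G_set_map :: "('a, 'm) groupoid_data_scheme \<Rightarrow> 'a set \<Rightarrow> 'a \<Rightarrow> 'a" where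
  "G_set_map G U = (\<lambda>x \<in> src G ` U. rng G (the_inv_into U (src G) x))"

definition topological_full_group :: "('a, 'm) groupoid_data_scheme \<Rightarrow> ('a \<Rightarrow> 'a) monoid" where
  "topological_full_group G =
     (BijGroup (unit_space G))
       \<lparr>carrier := {\<alpha> \<in> Bij (unit_space G).
          homeomorphic_map (unit_topology G) (unit_topology G) \<alpha> \<and>
          (\<exists>U. compact_open_G_set G U \<and>
               src G ` U = unit_space G \<and> rng G ` U = unit_space G \<and> \<alpha> = G_set_map G U)}\<rparr>"

definition properly_infinite :: "('a, 'm) groupoid_data_scheme \<Rightarrow> 'a set \<Rightarrow> bool" where
  "properly_infinite G A \<longleftrightarrow>
     openin (unit_topology G) A \<and> closedin (unit_topology G) A \<and>
     (\<exists>U V. compact_open_G_set G U \<and> compact_open_G_set G V \<and>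
            src G ` U = A \<and> src G ` V = A \<and>
            rng G ` U \<union> rng G ` V \<subseteq> A \<and> rng G ` U \<inter> rng G ` V = {})"


section \<open>Amenability of discrete groups\<close>

definition amenable_group :: "('a, 'm) monoid_scheme \<Rightarrow> bool" where
  "amenable_group G \<longleftrightarrow>
     (\<exists>\<mu> :: 'a set \<Rightarrow> real.
        (\<forall>A. A \<subseteq> carrier G \<longrightarrow> 0 \<le> \<mu> A) \<and>
        \<mu> (carrier G) = 1 \<and>
        (\<forall>A B. A \<subseteq> carrier G \<longrightarrow> B \<subseteq> carrier G \<longrightarrow> A \<inter> B = {} \<longrightarrow> \<mu> (A \<union> B) = \<mu> A + \<mu> B) \<and>
        (\<forall>g \<in> carrier G. \<forall>A. A \<subseteq> carrier G \<longrightarrow> \<mu> (g <#\<^bsub>G\<^esub> A) = \<mu> A))"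


section \<open>Free products of two groups\<close>

text \<open>
  The free product is realised on reduced words: lists of non-identity letters taken alternately
  from the two factors. \<open>fp_cons\<close> multiplies a reduced word by one letter from the left.
\<close>

definition reduced_words ::
    "('a, 'm) monoid_scheme \<Rightarrow> ('b, 'n) monoid_scheme \<Rightarrow> ('a + 'b) list set" where
  "reduced_words G H =
     {w. set w \<subseteq> Inl ` (carrier G - {\<one>\<^bsub>G\<^esub>}) \<union> Inr ` (carrier H - {\<one>\<^bsub>H\<^esub>}) \<and>
         successively (\<lambda>x y. isl x \<noteq> isl y) w}"

fun fp_cons ::
    "('a, 'm) monoid_scheme \<Rightarrow> ('b, 'n) monoid_scheme \<Rightarrow> 'a + 'b \<Rightarrow> ('a + 'b) list \<Rightarrow> ('a + 'b) list"
where
  "fp_cons G H (Inl a) (Inl b # w) =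
     (if a \<otimes>\<^bsub>G\<^esub> b = \<one>\<^bsub>G\<^esub> then w else Inl (a \<otimes>\<^bsub>G\<^esub> b) # w)"
| "fp_cons G H (Inr a) (Inr b # w) =
     (if a \<otimes>\<^bsub>H\<^esub> b = \<one>\<^bsub>H\<^esub> then w else Inr (a \<otimes>\<^bsub>H\<^esub> b) # w)"
| "fp_cons G H x w = x # w"

definition free_product ::
    "('a, 'm) monoid_scheme \<Rightarrow> ('b, 'n) monoid_scheme \<Rightarrow> ('a + 'b) list monoid" where
  "free_product G H =
     \<lparr>carrier = reduced_words G H, mult = foldr (fp_cons G H), one = []\<rparr>"

context
  fixes G :: "('a, 'm) monoid_scheme" and H :: "('b, 'n) monoid_scheme"
  assumes G: "group G" and H: "group H"
begin

interpretation G: group G by (rule G)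
interpretation H: group H by (rule H)

private abbreviation "L \<equiv> Inl ` (carrier G - {\<one>\<^bsub>G\<^esub>}) \<union> Inr ` (carrier H - {\<one>\<^bsub>H\<^esub>})"

private lemma fp_cons_closed:
  assumes "x \<in> L" "w \<in> reduced_words G H"
  shows "fp_cons G H x w \<in> reduced_words G H"
  using assms
  by (cases "(G, H, x, w)" rule: fp_cons.cases)
     (auto simp: reduced_words_def successively_Cons split: if_splits)

private lemma foldr_fp_cons_closed:
  assumes "set u \<subseteq> L" "w \<in> reduced_words G H"
  shows "foldr (fp_cons G H) u w \<in> reduced_words G H"
  using assms by (induction u) (auto intro!: fp_cons_closed)

private lemma fp_cons_Inl_Inl:
  assumes "a \<in> carrier G" "a \<noteq> \<one>\<^bsub>G\<^esub>" "b \<in> carrier G" "b \<noteq> \<one>\<^bsub>G\<^esub>" "w \<in> reduced_words G H"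
  shows "fp_cons G H (Inl a) (fp_cons G H (Inl b) w) =
    (if a \<otimes>\<^bsub>G\<^esub> b = \<one>\<^bsub>G\<^esub> then w else fp_cons G H (Inl (a \<otimes>\<^bsub>G\<^esub> b)) w)"
proof (cases "(G, H, Inl b :: 'a + 'b, w)" rule: fp_cons.cases)
  case (1 G' H' b' c w')
  then have w: "w = Inl c # w'" and c: "c \<in> carrier G" "c \<noteq> \<one>\<^bsub>G\<^esub>"
    and nl: "w' = [] \<or> \<not> isl (hd w')"
    using assms(5) by (auto simp: reduced_words_def successively_Cons)
  have sub: "fp_cons G H (Inl a) w' = Inl a # w'"
    using nl by (cases w' ; cases "hd w'") auto
  have assoc: "a \<otimes>\<^bsub>G\<^esub> b \<otimes>\<^bsub>G\<^esub> c = a \<otimes>\<^bsub>G\<^esub> (b \<otimes>\<^bsub>G\<^esub> c)"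
    using assms c by (simp add: G.m_assoc)
  have e1: "a \<otimes>\<^bsub>G\<^esub> b = \<one>\<^bsub>G\<^esub> \<Longrightarrow> a \<otimes>\<^bsub>G\<^esub> (b \<otimes>\<^bsub>G\<^esub> c) = c"
    using assoc c by (metis G.l_one)
  have e2: "b \<otimes>\<^bsub>G\<^esub> c = \<one>\<^bsub>G\<^esub> \<Longrightarrow> a \<otimes>\<^bsub>G\<^esub> b \<otimes>\<^bsub>G\<^esub> c = a"
    using assoc assms by (metis G.r_one)
  show ?thesis
    unfolding w using sub assoc e1 e2 c assms(2)
    by (cases "a \<otimes>\<^bsub>G\<^esub> b = \<one>\<^bsub>G\<^esub>"; cases "b \<otimes>\<^bsub>G\<^esub> c = \<one>\<^bsub>G\<^esub>") auto
qed (use assms in auto)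

private lemma fp_cons_Inr_Inr:
  assumes "a \<in> carrier H" "a \<noteq> \<one>\<^bsub>H\<^esub>" "b \<in> carrier H" "b \<noteq> \<one>\<^bsub>H\<^esub>" "w \<in> reduced_words G H"
  shows "fp_cons G H (Inr a) (fp_cons G H (Inr b) w) =
    (if a \<otimes>\<^bsub>H\<^esub> b = \<one>\<^bsub>H\<^esub> then w else fp_cons G H (Inr (a \<otimes>\<^bsub>H\<^esub> b)) w)"
proof (cases "(G, H, Inr b :: 'a + 'b, w)" rule: fp_cons.cases)
  case (2 G' H' b' c w')
  then have w: "w = Inr c # w'" and c: "c \<in> carrier H" "c \<noteq> \<one>\<^bsub>H\<^esub>"
    and nr: "w' = [] \<or> isl (hd w')"
    using assms(5) by (auto simp: reduced_words_def successively_Cons)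
  have sub: "fp_cons G H (Inr a) w' = Inr a # w'"
    using nr by (cases w' ; cases "hd w'") auto
  have assoc: "a \<otimes>\<^bsub>H\<^esub> b \<otimes>\<^bsub>H\<^esub> c = a \<otimes>\<^bsub>H\<^esub> (b \<otimes>\<^bsub>H\<^esub> c)"
    using assms c by (simp add: H.m_assoc)
  have e1: "a \<otimes>\<^bsub>H\<^esub> b = \<one>\<^bsub>H\<^esub> \<Longrightarrow> a \<otimes>\<^bsub>H\<^esub> (b \<otimes>\<^bsub>H\<^esub> c) = c"
    using assoc c by (metis H.l_one)
  have e2: "b \<otimes>\<^bsub>H\<^esub> c = \<one>\<^bsub>H\<^esub> \<Longrightarrow> a \<otimes>\<^bsub>H\<^esub> b \<otimes>\<^bsub>H\<^esub> c = a"
    using assoc assms by (metis H.r_one)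
  show ?thesis
    unfolding w using sub assoc e1 e2 c assms(2)
    by (cases "a \<otimes>\<^bsub>H\<^esub> b = \<one>\<^bsub>H\<^esub>"; cases "b \<otimes>\<^bsub>H\<^esub> c = \<one>\<^bsub>H\<^esub>") auto
qed (use assms in auto)

private lemma foldr_fp_cons_step:
  assumes "x \<in> L" "v \<in> reduced_words G H" "w \<in> reduced_words G H"
  shows "foldr (fp_cons G H) (fp_cons G H x v) w = fp_cons G H x (foldr (fp_cons G H) v w)"
proof (cases "(G, H, x, v)" rule: fp_cons.cases)
  case (1 G' H' a b v')
  then have xv: "x = Inl a" "v = Inl b # v'"
    by auto
  then have "foldr (fp_cons G H) v' w \<in> reduced_words G H"
    using assms by (intro foldr_fp_cons_closed) (auto simp: reduced_words_def)
  moreover have "a \<in> carrier G" "a \<noteq> \<one>\<^bsub>G\<^esub>" "b \<in> carrier G" "b \<noteq> \<one>\<^bsub>G\<^esub>"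
    using xv assms by (auto simp: reduced_words_def)
  ultimately show ?thesis
    using xv by (simp add: fp_cons_Inl_Inl)
next
  case (2 G' H' a b v')
  then have xv: "x = Inr a" "v = Inr b # v'"
    by auto
  then have "foldr (fp_cons G H) v' w \<in> reduced_words G H"
    using assms by (intro foldr_fp_cons_closed) (auto simp: reduced_words_def)
  moreover have "a \<in> carrier H" "a \<noteq> \<one>\<^bsub>H\<^esub>" "b \<in> carrier H" "b \<noteq> \<one>\<^bsub>H\<^esub>"
    using xv assms by (auto simp: reduced_words_def)
  ultimately show ?thesis
    using xv by (simp add: fp_cons_Inr_Inr)
qed auto

private lemma foldr_fp_cons_assoc:
  assumes "set u \<subseteq> L" "v \<in> reduced_words G H" "w \<in> reduced_words G H"
  shows "foldr (fp_cons G H) (foldr (fp_cons G H) u v) w =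
    foldr (fp_cons G H) u (foldr (fp_cons G H) v w)"
  using assms by (induction u) (auto simp: foldr_fp_cons_step foldr_fp_cons_closed)

private lemma foldr_fp_cons_reduced:
  "w \<in> reduced_words G H \<Longrightarrow> foldr (fp_cons G H) w [] = w"
proof (induction w)
  case (Cons x w)
  then have "w \<in> reduced_words G H" "w = [] \<or> isl x \<noteq> isl (hd w)"
    by (auto simp: reduced_words_def successively_Cons)
  with Cons.IH show ?case
    by (cases "(G, H, x, w)" rule: fp_cons.cases) auto
qed simp

private lemma letter_inverse:
  assumes "x \<in> L" shows "\<exists>y\<in>L. isl y = isl x \<and> fp_cons G H y [x] = []"
proof (cases x)
  case (Inl a)
  then show ?thesis using assms
    by (intro bexI[of _ "Inl (inv\<^bsub>G\<^esub> a)"]) auto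
next
  case (Inr a)
  then show ?thesis using assms
    by (intro bexI[of _ "Inr (inv\<^bsub>H\<^esub> a)"]) auto
qed

private lemma reduced_word_inverse:
  "w \<in> reduced_words G H \<Longrightarrow> \<exists>v\<in>reduced_words G H. foldr (fp_cons G H) v w = []"
proof (induction w)
  case Nil
  then show ?case by (auto intro!: bexI[of _ "[]"])
next
  case (Cons x w)
  then have w: "w \<in> reduced_words G H" and x: "x \<in> L" and hd: "w = [] \<or> isl x \<noteq> isl (hd w)"
    by (auto simp: reduced_words_def successively_Cons)
  obtain v where v: "v \<in> reduced_words G H" "foldr (fp_cons G H) v w = []"
    using Cons.IH w by blast
  obtain y where y: "y \<in> L" "isl y = isl x" "fp_cons G H y [x] = []"
    using letter_inverse x by blast
  have yr: "[y] \<in> reduced_words G H"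
    using y by (auto simp: reduced_words_def)
  have yx: "fp_cons G H y (x # w) = w"
    using y hd by (cases "(G, H, y, [x])" rule: fp_cons.cases) (auto split: if_splits)
  have "foldr (fp_cons G H) (foldr (fp_cons G H) v [y]) (x # w) = []"
    using v Cons.prems yr yx by (subst foldr_fp_cons_assoc) (auto simp: reduced_words_def)
  moreover have "foldr (fp_cons G H) v [y] \<in> reduced_words G H"
    using v yr by (intro foldr_fp_cons_closed) (auto simp: reduced_words_def)
  ultimately show ?case by blast
qed

lemma group_free_product: "group (free_product G H)"
proof (rule groupI)
  fix u v w
  assume "u \<in> carrier (free_product G H)" "v \<in> carrier (free_product G H)"
    "w \<in> carrier (free_product G H)"
  then show "u \<otimes>\<^bsub>free_product G H\<^esub> v \<otimes>\<^bsub>free_product G H\<^esub> w =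
      u \<otimes>\<^bsub>free_product G H\<^esub> (v \<otimes>\<^bsub>free_product G H\<^esub> w)"
    unfolding free_product_def
    by (simp add: foldr_fp_cons_assoc reduced_words_def)
next
  fix u v
  assume "u \<in> carrier (free_product G H)" "v \<in> carrier (free_product G H)"
  then show "u \<otimes>\<^bsub>free_product G H\<^esub> v \<in> carrier (free_product G H)"
    unfolding free_product_def
    using foldr_fp_cons_closed[of u v] by (simp add: reduced_words_def)
next
  fix w
  assume "w \<in> carrier (free_product G H)"
  then show "\<exists>v\<in>carrier (free_product G H).
      v \<otimes>\<^bsub>free_product G H\<^esub> w = \<one>\<^bsub>free_product G H\<^esub>"
    using reduced_word_inverse unfolding free_product_def by simp
qed (simp_all add: free_product_def reduced_words_def)

end

end

(*
  Proper infiniteness gives u, v : X -> X implemented by compact open G-sets, with disjoint images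
  (X the unit space).  Put A = u(X) and B = v(u(X)); these are disjoint clopen sets and v(v(X))
  lies outside both.  The complement of B is disjoint from its image under v u, which lies in B;
  interchanging the two gives an element of order 2 mapping X - B into B.  The complement of A and
  its images under u u and u v, which lie in A, are disjoint; permuting them cyclically gives an
  element of order 3 whose nontrivial powers map X - A into A.  A nonempty reduced word in the two
  elements therefore moves any point p outside A and B into A or B, so they generate a free
  product.  An invariant mean on [[G]], pushed forward along the orbit of p, would give B mass at
  least 1/2 and A mass at least 2/3.
*)
theory Submission
  imports Defs "HOL-Algebra.Group_Action"
begin

section \<open>Free products and ping-pong\<close>

text \<open>The map that the universal property of the free product assigns to \<open>f\<close> and
  \<open>g\<close>, evaluated letter by letter on a word.\<close>

definition free_product_lift ::
    "('c, 'k) monoid_scheme \<Rightarrow> ('a \<Rightarrow> 'c) \<Rightarrow> ('b \<Rightarrow> 'c) \<Rightarrow> ('a + 'b) list \<Rightarrow> 'c" where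
  "free_product_lift K f g w = foldr (\<lambda>x y. case_sum f g x \<otimes>\<^bsub>K\<^esub> y) w \<one>\<^bsub>K\<^esub>"

lemma free_product_lift_simps [simp]:
  "free_product_lift K f g [] = \<one>\<^bsub>K\<^esub>"
  "free_product_lift K f g (x # w) = case_sum f g x \<otimes>\<^bsub>K\<^esub> free_product_lift K f g w"
  by (simp_all add: free_product_lift_def)

lemma reduced_words_Cons:
  "x # w \<in> reduced_words G H \<longleftrightarrow>
     x \<in> Inl ` (carrier G - {\<one>\<^bsub>G\<^esub>}) \<union> Inr ` (carrier H - {\<one>\<^bsub>H\<^esub>}) \<and>
     w \<in> reduced_words G H \<and> (w = [] \<or> isl x \<noteq> isl (hd w))"
  by (auto simp: reduced_words_def successively_Cons)

locale free_product_homs =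
  G: group G + H: group H + K: group K
  for G :: "('a, 'm) monoid_scheme" and H :: "('b, 'n) monoid_scheme"
    and K :: "('c, 'k) monoid_scheme" +
  fixes f g
  assumes f: "f \<in> hom G K" and g: "g \<in> hom H K"
begin

lemma letter_closed:
  "x \<in> Inl ` (carrier G - {\<one>\<^bsub>G\<^esub>}) \<union> Inr ` (carrier H - {\<one>\<^bsub>H\<^esub>}) \<Longrightarrow> case_sum f g x \<in> carrier K"
  using f g by (auto simp: hom_in_carrier)

lemma lift_closed: "w \<in> reduced_words G H \<Longrightarrow> free_product_lift K f g w \<in> carrier K"
  by (induction w) (auto simp: reduced_words_Cons intro!: hom_in_carrier [OF f] hom_in_carrier [OF g])

text \<open>Multiplying by a letter prepends it, merges it with the head, or cancels the head.
  Prepending agrees with the recursion of the lift; the other two cases use that \<open>f\<close>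
  and \<open>g\<close> respect products and identities.\<close>

lemma lift_fp_cons:
  assumes x: "x \<in> Inl ` (carrier G - {\<one>\<^bsub>G\<^esub>}) \<union> Inr ` (carrier H - {\<one>\<^bsub>H\<^esub>})"
    and w: "w \<in> reduced_words G H"
  shows "free_product_lift K f g (fp_cons G H x w) = case_sum f g x \<otimes>\<^bsub>K\<^esub> free_product_lift K f g w"
proof (cases "(G, H, x, w)" rule: fp_cons.cases)
  case (1 G' H' a b w')
  then have xw: "x = Inl a" "w = Inl b # w'" and ab: "a \<in> carrier G" "b \<in> carrier G"
    and w': "w' \<in> reduced_words G H"
    using x w by (auto simp: reduced_words_Cons)
  have "f (a \<otimes>\<^bsub>G\<^esub> b) \<otimes>\<^bsub>K\<^esub> free_product_lift K f g w' = f a \<otimes>\<^bsub>K\<^esub> (f b \<otimes>\<^bsub>K\<^esub> free_product_lift K f g w')"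
    using ab w' f by (simp add: hom_mult K.m_assoc hom_in_carrier lift_closed)
  moreover have "f \<one>\<^bsub>G\<^esub> = \<one>\<^bsub>K\<^esub>"
    using f G.group_axioms K.group_axioms by (rule hom_one)
  ultimately show ?thesis
    using xw w' by (auto simp: lift_closed)
next
  case (2 G' H' a b w')
  then have xw: "x = Inr a" "w = Inr b # w'" and ab: "a \<in> carrier H" "b \<in> carrier H"
    and w': "w' \<in> reduced_words G H"
    using x w by (auto simp: reduced_words_Cons)
  have "g (a \<otimes>\<^bsub>H\<^esub> b) \<otimes>\<^bsub>K\<^esub> free_product_lift K f g w' = g a \<otimes>\<^bsub>K\<^esub> (g b \<otimes>\<^bsub>K\<^esub> free_product_lift K f g w')"
    using ab w' g by (simp add: hom_mult K.m_assoc hom_in_carrier lift_closed)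
  moreover have "g \<one>\<^bsub>H\<^esub> = \<one>\<^bsub>K\<^esub>"
    using g H.group_axioms K.group_axioms by (rule hom_one)
  ultimately show ?thesis
    using xw w' by (auto simp: lift_closed)
qed auto

text \<open>Multiplication of words applies \<open>fp_cons\<close> once for each letter of the left
  factor, so induction on that factor reduces the claim to \<open>lift_fp_cons\<close>.\<close>

lemma lift_hom: "free_product_lift K f g \<in> hom (free_product G H) K"
proof (rule homI)
  fix u assume u: "u \<in> carrier (free_product G H)"
  then show "free_product_lift K f g u \<in> carrier K"
    by (simp add: free_product_def lift_closed)
  fix w assume "w \<in> carrier (free_product G H)"
  then have w: "w \<in> reduced_words G H"
    by (simp add: free_product_def)
  interpret FP: group "free_product G H"
    by (rule group_free_product) (rule G.group_axioms H.group_axioms)+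
  have "free_product_lift K f g (foldr (fp_cons G H) u w)
      = free_product_lift K f g u \<otimes>\<^bsub>K\<^esub> free_product_lift K f g w"
    if "u \<in> reduced_words G H" using that
  proof (induction u)
    case Nil
    then show ?case using w by (simp add: lift_closed)
  next
    case (Cons x u)
    then have u: "u \<in> reduced_words G H" by (simp add: reduced_words_Cons)
    \<comment> \<open>\<open>lift_fp_cons\<close> speaks of reduced words only; the partial product
      is one because the free product is closed under multiplication.\<close>
    then have "foldr (fp_cons G H) u w \<in> reduced_words G H"
      using FP.m_closed [of u w] w by (simp add: free_product_def)
    then show ?case
      using Cons u w
      by (simp add: reduced_words_Cons lift_fp_cons lift_closed letter_closed K.m_assoc)
  qed
  with u show "free_product_lift K f g (u \<otimes>\<^bsub>free_product G H\<^esub> w)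
      = free_product_lift K f g u \<otimes>\<^bsub>K\<^esub> free_product_lift K f g w"
    by (simp add: free_product_def)
qed

text \<open>Ping-pong lemma. A nonempty reduced word takes \<open>p\<close> into the set belonging
  to the factor of its first letter, which acts last. As \<open>p\<close> lies in neither set, such
  a word cannot act as the identity, so the kernel is trivial.\<close>

lemma lift_ping_pong_inj:
  assumes act: "group_action K X \<phi>"
    and sub: "A \<subseteq> X" "B \<subseteq> X" and disj: "A \<inter> B = {}" and p: "p \<in> X - (A \<union> B)"
    and f': "\<And>a. a \<in> carrier G - {\<one>\<^bsub>G\<^esub>} \<Longrightarrow> \<phi> (f a) ` (X - B) \<subseteq> B"
    and g': "\<And>b. b \<in> carrier H - {\<one>\<^bsub>H\<^esub>} \<Longrightarrow> \<phi> (g b) ` (X - A) \<subseteq> A"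
  shows "inj_on (free_product_lift K f g) (carrier (free_product G H))"
proof -
  interpret group_action K X \<phi> by (rule act)
  have one: "\<phi> \<one>\<^bsub>K\<^esub> p = p"
    using p id_eq_one by (metis DiffD1 restrict_apply')
  have orbit: "\<phi> (free_product_lift K f g w) p \<in> (if isl (hd w) then B else A)"
    if "w \<in> reduced_words G H" "w \<noteq> []" for w
    using that
  proof (induction w)
    case (Cons x w)
    then have x: "x \<in> Inl ` (carrier G - {\<one>\<^bsub>G\<^esub>}) \<union> Inr ` (carrier H - {\<one>\<^bsub>H\<^esub>})"
      and w: "w \<in> reduced_words G H" and hd: "w = [] \<or> isl x \<noteq> isl (hd w)"
      by (auto simp: reduced_words_Cons)
    \<comment> \<open>Before the next letter acts, the point lies where that letter can push it: it
      is \<open>p\<close> itself, or alternation has put it in the other of the two disjoint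
      sets.\<close>
    have "\<phi> (free_product_lift K f g w) p \<in> (if isl x then X - B else X - A)"
    proof (cases "w = []")
      case True
      then show ?thesis using p by (simp add: one)
    next
      case False
      then show ?thesis using Cons.IH [OF w False] hd sub disj by (auto split: if_splits)
    qed
    moreover have "\<phi> (free_product_lift K f g (x # w)) p
        = \<phi> (case_sum f g x) (\<phi> (free_product_lift K f g w) p)"
      using p x w by (simp add: composition_rule letter_closed lift_closed)
    ultimately show ?case
      using x f' g' by fastforce
  qed simp
  have "w = []" if "w \<in> reduced_words G H" "free_product_lift K f g w = \<one>\<^bsub>K\<^esub>" for w
  proof (rule ccontr)
    assume "w \<noteq> []"
    then have "\<phi> \<one>\<^bsub>K\<^esub> p \<in> A \<union> B"
      using orbit that by (metis UnI1 UnI2)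
    then show False using p by (simp add: one)
  qed
  then show ?thesis
    using inj_on_one_iff' [OF lift_hom group_free_product [OF G.group_axioms H.group_axioms]
        K.group_axioms]
    by (simp add: free_product_def)
qed

lemma ex_subgroup_iso_free_product:
  assumes inj: "inj_on (free_product_lift K f g) (carrier (free_product G H))"
  shows "\<exists>S. subgroup S K \<and> K\<lparr>carrier := S\<rparr> \<cong> free_product G H"
proof -
  let ?F = "free_product G H" and ?l = "free_product_lift K f g"
  interpret FP: group ?F
    by (rule group_free_product) (rule G.group_axioms H.group_axioms)+
  interpret l: group_hom ?F K ?l
    by unfold_locales (rule lift_hom)
  have "?l \<in> iso ?F (K\<lparr>carrier := ?l ` carrier ?F\<rparr>)"
    using inj by (auto simp: iso_def hom_def bij_betw_def)
  then have "K\<lparr>carrier := ?l ` carrier ?F\<rparr> \<cong> ?F"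
    using FP.iso_sym is_isoI by blast
  then show ?thesis
    using l.img_is_subgroup by blast
qed

end

section \<open>A criterion for non-amenability\<close>

text \<open>Invariance gives \<open>\<mu> N \<ge> 1/2\<close> and \<open>\<mu> M \<ge> 2/3\<close>.\<close>

lemma (in group) not_amenable_if_paradoxical:
  assumes sub: "M \<subseteq> carrier G" "N \<subseteq> carrier G" and disj: "M \<inter> N = {}"
    and mem: "s \<in> carrier G" "t \<in> carrier G" "t' \<in> carrier G"
    and s: "s <#\<^bsub>G\<^esub> (carrier G - N) \<subseteq> N"
    and t: "t <#\<^bsub>G\<^esub> (carrier G - M) \<subseteq> M" "t' <#\<^bsub>G\<^esub> (carrier G - M) \<subseteq> M"
      "(t <#\<^bsub>G\<^esub> (carrier G - M)) \<inter> (t' <#\<^bsub>G\<^esub> (carrier G - M)) = {}"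
  shows "\<not> amenable_group G"
proof
  assume "amenable_group G"
  then obtain \<mu> :: "'a set \<Rightarrow> real" where \<mu>:
    "\<forall>A. A \<subseteq> carrier G \<longrightarrow> 0 \<le> \<mu> A" "\<mu> (carrier G) = 1"
    "\<forall>A B. A \<subseteq> carrier G \<longrightarrow> B \<subseteq> carrier G \<longrightarrow> A \<inter> B = {} \<longrightarrow> \<mu> (A \<union> B) = \<mu> A + \<mu> B"
    "\<forall>g \<in> carrier G. \<forall>A. A \<subseteq> carrier G \<longrightarrow> \<mu> (g <#\<^bsub>G\<^esub> A) = \<mu> A"
    unfolding amenable_group_def by (elim exE conjE) (rule that)
  note total = \<mu>(2)
  have add: "\<mu> (A \<union> B) = \<mu> A + \<mu> B"
    if "A \<subseteq> carrier G" "B \<subseteq> carrier G" "A \<inter> B = {}" for A B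
    using \<mu>(3) that by blast
  have inv: "\<mu> (g <#\<^bsub>G\<^esub> A) = \<mu> A" if "g \<in> carrier G" "A \<subseteq> carrier G" for g A
    using \<mu>(4) that by blast
  have mono: "\<mu> A \<le> \<mu> B" if "A \<subseteq> B" "B \<subseteq> carrier G" for A B
  proof -
    have "\<mu> (A \<union> (B - A)) = \<mu> A + \<mu> (B - A)"
      using that by (intro add) auto
    moreover have "0 \<le> \<mu> (B - A)"
      using \<mu>(1) that by blast
    ultimately show ?thesis
      using that by (simp add: Un_absorb1)
  qed
  have compl: "\<mu> (carrier G - A) = 1 - \<mu> A" if "A \<subseteq> carrier G" for A
    using that add [of A "carrier G - A"] total by (simp add: Un_absorb1)
  \<comment> \<open>The translate by \<open>s\<close> has the mass of the complement of
    \<open>N\<close>, yet fits inside \<open>N\<close>.\<close>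
  have "1 - \<mu> N \<le> \<mu> N"
    using mono [OF s sub(2)] mem sub by (simp add: inv compl)
  moreover have "2 * (1 - \<mu> M) \<le> \<mu> M"
  proof -
    have "\<mu> ((t <#\<^bsub>G\<^esub> (carrier G - M)) \<union> (t' <#\<^bsub>G\<^esub> (carrier G - M))) \<le> \<mu> M"
      using t sub by (intro mono) auto
    moreover have "\<mu> ((t <#\<^bsub>G\<^esub> (carrier G - M)) \<union> (t' <#\<^bsub>G\<^esub> (carrier G - M)))
        = \<mu> (t <#\<^bsub>G\<^esub> (carrier G - M)) + \<mu> (t' <#\<^bsub>G\<^esub> (carrier G - M))"
      using t sub by (intro add) auto
    ultimately show ?thesis
      using mem sub by (simp add: inv compl)
  qed
  \<comment> \<open>Disjoint sets have total mass at most 1, whereas 1/2 + 2/3 exceeds 1.\<close>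
  moreover have "\<mu> M + \<mu> N \<le> 1"
    using add [OF sub disj] mono [of "M \<union> N" "carrier G"] sub total by simp
  ultimately show False by argo
qed

text \<open>Pulling sets back along the orbit map of \<open>p\<close> turns a paradoxical
  arrangement in the space into one in the group: \<open>orb S\<close> collects the elements that
  take \<open>p\<close> into \<open>S\<close>, and this preserves inclusion and disjointness and is
  compatible with left translation.\<close>

lemma (in group_action) not_amenable_if_paradoxical_action:
  assumes p: "p \<in> E" and disj: "A \<inter> B = {}"
    and mem: "s \<in> carrier G" "t \<in> carrier G" "t' \<in> carrier G"
    and s: "\<phi> s ` (E - B) \<subseteq> B"
    and t: "\<phi> t ` (E - A) \<subseteq> A" "\<phi> t' ` (E - A) \<subseteq> A" "\<phi> t ` (E - A) \<inter> \<phi> t' ` (E - A) = {}"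
  shows "\<not> amenable_group G"
proof -
  interpret G: group G by (rule group_hom group_hom.axioms(1) [OF group_hom])
  define orb where "orb S = {g \<in> carrier G. \<phi> g p \<in> S}" for S
  have in_E: "\<phi> g p \<in> E" if "g \<in> carrier G" for g
    using that p element_image by blast
  \<comment> \<open>An element outside \<open>orb S\<close> takes \<open>p\<close> into
    \<open>E - S\<close>, because orbits stay in \<open>E\<close>.\<close>
  have coset: "g <#\<^bsub>G\<^esub> (carrier G - orb S) \<subseteq> orb (\<phi> g ` (E - S))" if "g \<in> carrier G" for g S
    using that p in_E by (auto simp: orb_def l_coset_def composition_rule)
  have mono: "orb S \<subseteq> orb T" if "S \<subseteq> T" for S T
    using that by (auto simp: orb_def)
  show ?thesis
  proof (rule G.not_amenable_if_paradoxical)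
    show "orb A \<subseteq> carrier G" "orb B \<subseteq> carrier G" "orb A \<inter> orb B = {}"
      using disj by (auto simp: orb_def)
    show "s <#\<^bsub>G\<^esub> (carrier G - orb B) \<subseteq> orb B"
      using coset [OF mem(1)] mono [OF s] by (rule subset_trans)
    show "t <#\<^bsub>G\<^esub> (carrier G - orb A) \<subseteq> orb A"
      using coset [OF mem(2)] mono [OF t(1)] by (rule subset_trans)
    show "t' <#\<^bsub>G\<^esub> (carrier G - orb A) \<subseteq> orb A"
      using coset [OF mem(3)] mono [OF t(2)] by (rule subset_trans)
    have "orb (\<phi> t ` (E - A)) \<inter> orb (\<phi> t' ` (E - A)) = {}"
      using t(3) by (auto simp: orb_def)
    then show "(t <#\<^bsub>G\<^esub> (carrier G - orb A)) \<inter> (t' <#\<^bsub>G\<^esub> (carrier G - orb A)) = {}"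
      using coset [OF mem(2), of A] coset [OF mem(3), of A] by blast
  qed (fact mem)+
qed

section \<open>Compact open G-sets\<close>

context topological_groupoid
begin

lemma ginv_ginv:
  assumes g: "g \<in> arrow_set G"
  shows "ginv G (ginv G g) = g"
proof -
  let ?i = "ginv G g" and ?j = "ginv G (ginv G g)"
  have i: "?i \<in> arrow_set G" and j: "?j \<in> arrow_set G"
    using g by (simp_all add: ginv_closed)
  have "?j = gmult G ?j (src G ?j)"
    using j by (simp add: gmult_src)
  also have "\<dots> = gmult G ?j (gmult G ?i g)"
    using g i by (simp add: ginv_gmult src_ginv rng_ginv)
  also have "\<dots> = gmult G (gmult G ?j ?i) g"
    using g i j by (intro gmult_assoc [symmetric]) (auto simp: composable_def src_ginv rng_ginv)
  also have "\<dots> = g"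
    using g i by (simp add: ginv_gmult src_ginv rng_gmult_left)
  finally show ?thesis .
qed

lemma ginv_gmult_cancel:
  assumes "g \<in> arrow_set G" "h \<in> arrow_set G" "src G g = rng G h"
  shows "gmult G (ginv G g) (gmult G g h) = h"
  using assms gmult_assoc [of "ginv G g" g h]
  by (simp add: composable_def ginv_closed src_ginv ginv_gmult rng_gmult_left)

lemma gmult_ginv_cancel:
  assumes "g \<in> arrow_set G" "h \<in> arrow_set G" "rng G g = rng G h"
  shows "gmult G g (gmult G (ginv G g) h) = h"
  using assms gmult_assoc [of g "ginv G g" h]
  by (simp add: composable_def ginv_closed src_ginv rng_ginv gmult_ginv rng_gmult_left)

lemma unit_space_subset: "unit_space G \<subseteq> arrow_set G"
  by (auto simp: unit_space_def src_closed)

lemma src_unit: "x \<in> unit_space G \<Longrightarrow> src G x = x"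
  by (auto simp: unit_space_def src_src)

lemma rng_unit: "x \<in> unit_space G \<Longrightarrow> rng G x = x"
  by (auto simp: unit_space_def rng_src)

lemma src_in_unit_space: "g \<in> arrow_set G \<Longrightarrow> src G g \<in> unit_space G"
  by (simp add: unit_space_def)

lemma rng_in_unit_space: "g \<in> arrow_set G \<Longrightarrow> rng G g \<in> unit_space G"
  by (metis rng_closed src_rng src_in_unit_space)

section \<open>Continuity of the structure maps, and inverses of G-sets\<close>

lemma continuous_map_gmult:
  assumes "continuous_map X (arrows G) f" "continuous_map X (arrows G) k"
    and "\<And>x. x \<in> topspace X \<Longrightarrow> src G (f x) = rng G (k x)"
  shows "continuous_map X (arrows G) (\<lambda>x. gmult G (f x) (k x))"
proof -
  have "continuous_map X (subtopology (prod_topology (arrows G) (arrows G)) (composable G))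
      (\<lambda>x. (f x, k x))"
    using assms continuous_map_funspace [OF assms(1)] continuous_map_funspace [OF assms(2)]
    by (intro continuous_map_into_subtopology continuous_map_pairedI) (auto simp: composable_def)
  from continuous_map_compose [OF this continuous_gmult] show ?thesis
    by (simp add: o_def)
qed

text \<open>The range of an arrow is its product with its inverse, so continuity of multiplication
  and inversion carries over to the range map.\<close>

lemma continuous_map_rng: "continuous_map (arrows G) (arrows G) (rng G)"
proof -
  have "continuous_map (arrows G) (arrows G) (\<lambda>g. gmult G g (ginv G g))"
    by (rule continuous_map_gmult) (auto simp: continuous_ginv rng_ginv)
  then show ?thesis
    by (rule continuous_map_eq) (simp add: gmult_ginv)
qed

lemma continuous_map_src: "continuous_map (arrows G) (arrows G) (src G)"
proof -
  have "continuous_map (arrows G) (arrows G) (rng G \<circ> ginv G)"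
    by (rule continuous_map_compose [OF continuous_ginv continuous_map_rng])
  then show ?thesis
    by (rule continuous_map_eq) (simp add: rng_ginv)
qed

lemma src_image_ginv: "U \<subseteq> arrow_set G \<Longrightarrow> src G ` ginv G ` U = rng G ` U"
  by (force simp: image_image src_ginv)

lemma rng_image_ginv: "U \<subseteq> arrow_set G \<Longrightarrow> rng G ` ginv G ` U = src G ` U"
  by (force simp: image_image rng_ginv)

lemma openin_image_ginv:
  assumes "openin (arrows G) U"
  shows "openin (arrows G) (ginv G ` U)"
proof -
  have "ginv G ` U = {g \<in> arrow_set G. ginv G g \<in> U}"
    using openin_subset [OF assms] by (force simp: ginv_ginv ginv_closed image_iff)
  then show ?thesis
    using openin_continuous_map_preimage [OF continuous_ginv assms] by simp
qed

lemma compact_open_G_set_ginv: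
  assumes "compact_open_G_set G U"
  shows "compact_open_G_set G (ginv G ` U)"
proof -
  have U: "U \<subseteq> arrow_set G" "inj_on (src G) U" "inj_on (rng G) U"
    using assms by (auto simp: compact_open_G_set_def G_set_def)
  have "inj_on (src G) (ginv G ` U)" "inj_on (rng G) (ginv G ` U)"
    using U by (auto simp: inj_on_def src_ginv rng_ginv subset_iff)
  moreover have "ginv G ` U \<subseteq> arrow_set G"
    using U by (auto simp: ginv_closed)
  ultimately show ?thesis
    using assms openin_image_ginv image_compactin [OF _ continuous_ginv]
    by (auto simp: compact_open_G_set_def G_set_def)
qed

text \<open>The product of G-sets; the partial map attached to it is the composite of those attached
  to \<open>V\<close> and \<open>U\<close>, the one of \<open>V\<close> being applied first.\<close>

definition G_set_prod :: "'a set \<Rightarrow> 'a set \<Rightarrow> 'a set" where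
  "G_set_prod U V = {gmult G g h |g h. g \<in> U \<and> h \<in> V \<and> src G g = rng G h}"

text \<open>Left multiplication of \<open>k\<close> by the inverse of the arrow of \<open>U\<close>
  that shares its range. It is meaningful when such an arrow exists and is unique, and it turns
  multiplication by a G-set into a function of \<open>k\<close> alone, whose continuity can be
  used.\<close>

definition left_translate :: "'a set \<Rightarrow> 'a \<Rightarrow> 'a" where
  "left_translate U k = gmult G (ginv G (the_inv_into U (rng G) (rng G k))) k"

end

text \<open>Openness of the units lets a set open in the unit topology count as open among the
  arrows; together with compactness it makes every clopen set of units a compact open G-set.\<close>

locale etale_groupoid_compact_units = etale_groupoid G
  for G :: "('a, 'm) groupoid_data_scheme" +
  assumes open_units: "openin (arrows G) (unit_space G)"
    and compact_units: "compactin (arrows G) (unit_space G)"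
begin

text \<open>A local homeomorphism is an open map: around each point the image is open in the unit
  topology, hence open among all arrows.\<close>

lemma openin_rng_image:
  assumes "openin (arrows G) W"
  shows "openin (arrows G) (rng G ` W)"
proof (subst openin_subopen, intro ballI)
  fix y assume "y \<in> rng G ` W"
  then obtain x where x: "x \<in> W" "y = rng G x" by blast
  then have "x \<in> arrow_set G"
    using openin_subset [OF assms] by blast
  then obtain U where U: "openin (arrows G) U" "x \<in> U" "openin (unit_topology G) (rng G ` U)"
      "homeomorphic_map (subtopology (arrows G) U) (subtopology (unit_topology G) (rng G ` U)) (rng G)"
    using rng_local_homeomorphism unfolding local_homeomorphism_def by blast
  have "openin (subtopology (arrows G) U) (W \<inter> U)"
    using assms by (rule openin_subtopology_Int)
  then have "openin (subtopology (unit_topology G) (rng G ` U)) (rng G ` (W \<inter> U))"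
    using homeomorphic_imp_open_map [OF U(4)] by (simp add: open_map_def)
  then have "openin (unit_topology G) (rng G ` (W \<inter> U))"
    using U(3) openin_trans_full by blast
  then have "openin (arrows G) (rng G ` (W \<inter> U))"
    unfolding unit_topology_def using open_units openin_trans_full by blast
  then show "\<exists>T. openin (arrows G) T \<and> y \<in> T \<and> T \<subseteq> rng G ` W"
    using x U(2) by blast
qed

lemma openin_src_image:
  assumes "openin (arrows G) W"
  shows "openin (arrows G) (src G ` W)"
  using openin_rng_image [OF openin_image_ginv [OF assms]] openin_subset [OF assms]
  by (simp add: rng_image_ginv)

text \<open>The preimage of an open \<open>W\<close> is the range image of
  \<open>U \<inter> W\<close>, which is open because the range map is open.\<close>

lemma continuous_map_the_inv_into_rng:
  assumes U: "openin (arrows G) U" "inj_on (rng G) U"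
  shows "continuous_map (subtopology (arrows G) (rng G ` U)) (arrows G) (the_inv_into U (rng G))"
  unfolding continuous_map_alt
proof (intro conjI allI impI)
  have sub: "U \<subseteq> arrow_set G"
    using U openin_subset by blast
  show "the_inv_into U (rng G) \<in> topspace (subtopology (arrows G) (rng G ` U)) \<rightarrow> arrow_set G"
    using U sub by (auto simp: the_inv_into_f_f)
  fix W assume "openin (arrows G) W"
  then have "openin (arrows G) (rng G ` (U \<inter> W))"
    by (intro openin_rng_image openin_Int U)
  moreover have "the_inv_into U (rng G) -` W \<inter> topspace (subtopology (arrows G) (rng G ` U))
      = rng G ` (U \<inter> W)"
    using U sub by (auto simp: the_inv_into_f_f rng_closed)
  ultimately show "openin (subtopology (arrows G) (rng G ` U))
      (the_inv_into U (rng G) -` W \<inter> topspace (subtopology (arrows G) (rng G ` U)))"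
    by (auto simp: openin_subtopology)
qed

lemma continuous_map_left_translate:
  assumes U: "openin (arrows G) U" "inj_on (rng G) U"
  shows "continuous_map (subtopology (arrows G) {k \<in> arrow_set G. rng G k \<in> rng G ` U})
    (arrows G) (left_translate U)"
  unfolding left_translate_def [abs_def]
proof (rule continuous_map_gmult)
  let ?D = "subtopology (arrows G) {k \<in> arrow_set G. rng G k \<in> rng G ` U}"
  have "continuous_map ?D (subtopology (arrows G) (rng G ` U)) (rng G)"
    by (intro continuous_map_into_subtopology continuous_map_from_subtopology continuous_map_rng)
      auto
  then have "continuous_map ?D (arrows G) (the_inv_into U (rng G) \<circ> rng G)"
    by (rule continuous_map_compose) (rule continuous_map_the_inv_into_rng [OF U])
  then have "continuous_map ?D (arrows G) (ginv G \<circ> (the_inv_into U (rng G) \<circ> rng G))"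
    using continuous_ginv by (rule continuous_map_compose)
  then show "continuous_map ?D (arrows G) (\<lambda>k. ginv G (the_inv_into U (rng G) (rng G k)))"
    by (simp add: o_def)
  show "continuous_map ?D (arrows G) (\<lambda>k. k)"
    by (simp add: continuous_map_from_subtopology)
  fix k assume "k \<in> topspace ?D"
  then obtain g where "g \<in> U" "rng G k = rng G g" by auto
  then show "src G (ginv G (the_inv_into U (rng G) (rng G k))) = rng G k"
    using U openin_subset [OF U(1)] by (auto simp: the_inv_into_f_f src_ginv)
qed

lemma left_translate_eq:
  assumes "inj_on (rng G) U" "g \<in> U" "rng G g = rng G k"
  shows "left_translate U k = gmult G (ginv G g) k"
  unfolding left_translate_def using assms by (metis the_inv_into_f_f)

text \<open>Left translation by \<open>U\<close> and by its inverse are mutually inverse; the first exhibits the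
  product as an open set, the second as a compact one.\<close>

lemma compact_open_G_set_prod:
  assumes U: "compact_open_G_set G U" and V: "compact_open_G_set G V"
  shows "compact_open_G_set G (G_set_prod U V)"
proof -
  have Uo: "openin (arrows G) U" and Us: "U \<subseteq> arrow_set G"
    and Ur: "inj_on (rng G) U" and Usrc: "inj_on (src G) U" and Uc: "compactin (arrows G) U"
    using U by (auto simp: compact_open_G_set_def G_set_def)
  have Vo: "openin (arrows G) V" and Vs: "V \<subseteq> arrow_set G"
    and Vr: "inj_on (rng G) V" and Vsrc: "inj_on (src G) V" and Vc: "compactin (arrows G) V"
    using V by (auto simp: compact_open_G_set_def G_set_def)
  have memP: "gmult G g h \<in> arrow_set G" "src G (gmult G g h) = src G h"
      "rng G (gmult G g h) = rng G g"
    if "g \<in> U" "h \<in> V" "src G g = rng G h" for g h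
    using that Us Vs
    by (auto intro!: gmult_closed src_gmult rng_gmult simp: composable_def)
  have "G_set_prod U V \<subseteq> arrow_set G"
    using memP by (auto simp: G_set_prod_def)
  moreover have "inj_on (src G) (G_set_prod U V)"
  proof (rule inj_onI)
    fix k k' assume "k \<in> G_set_prod U V" "k' \<in> G_set_prod U V" "src G k = src G k'"
    then obtain g h g' h' where k: "k = gmult G g h" "g \<in> U" "h \<in> V" "src G g = rng G h"
        and k': "k' = gmult G g' h'" "g' \<in> U" "h' \<in> V" "src G g' = rng G h'"
        and "src G h = src G h'"
      by (auto simp: G_set_prod_def memP)
    then have "h = h'" using Vsrc by (auto dest: inj_onD)
    then have "g = g'" using k k' Usrc by (metis inj_onD)
    with \<open>h = h'\<close> show "k = k'" using k k' by simp
  qed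
  moreover have "inj_on (rng G) (G_set_prod U V)"
  proof (rule inj_onI)
    fix k k' assume "k \<in> G_set_prod U V" "k' \<in> G_set_prod U V" "rng G k = rng G k'"
    then obtain g h g' h' where k: "k = gmult G g h" "g \<in> U" "h \<in> V" "src G g = rng G h"
        and k': "k' = gmult G g' h'" "g' \<in> U" "h' \<in> V" "src G g' = rng G h'"
        and "rng G g = rng G g'"
      by (auto simp: G_set_prod_def memP)
    then have "g = g'" using Ur by (auto dest: inj_onD)
    then have "h = h'" using k k' Vr by (metis inj_onD)
    with \<open>g = g'\<close> show "k = k'" using k k' by simp
  qed
  moreover have "openin (arrows G) (G_set_prod U V)"
  proof -
    let ?D = "{k \<in> arrow_set G. rng G k \<in> rng G ` U}"
    have "openin (arrows G) ?D"
      by (intro openin_continuous_map_preimage [OF continuous_map_rng] openin_rng_image Uo)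
    moreover have "openin (subtopology (arrows G) ?D)
        {k \<in> topspace (subtopology (arrows G) ?D). left_translate U k \<in> V}"
      by (rule openin_continuous_map_preimage [OF continuous_map_left_translate [OF Uo Ur] Vo])
    ultimately have "openin (arrows G)
        {k \<in> topspace (subtopology (arrows G) ?D). left_translate U k \<in> V}"
      by (rule openin_trans_full [rotated])
    \<comment> \<open>If \<open>g\<close> in \<open>U\<close> has the range of \<open>k\<close>,
      then \<open>k\<close> is \<open>g\<close> times the translate of \<open>k\<close>; so
      \<open>k\<close> is a product of arrows from \<open>U\<close> and \<open>V\<close> exactly
      when its translate is in \<open>V\<close>.\<close>
    also have "{k \<in> topspace (subtopology (arrows G) ?D). left_translate U k \<in> V} = G_set_prod U V"
    proof (intro equalityI subsetI)
      fix k assume "k \<in> {k \<in> topspace (subtopology (arrows G) ?D). left_translate U k \<in> V}"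
      then obtain g where g: "g \<in> U" "rng G g = rng G k" "k \<in> arrow_set G"
          "gmult G (ginv G g) k \<in> V"
        using Ur by (auto simp: left_translate_eq)
      moreover have "rng G (gmult G (ginv G g) k) = src G g"
        using g Us by (subst rng_gmult) (auto simp: composable_def ginv_closed src_ginv rng_ginv)
      moreover have "gmult G g (gmult G (ginv G g) k) = k"
        using g Us by (intro gmult_ginv_cancel) auto
      ultimately show "k \<in> G_set_prod U V"
        unfolding G_set_prod_def by (metis (mono_tags, lifting) mem_Collect_eq)
    next
      fix k assume "k \<in> G_set_prod U V"
      then obtain g h where k: "k = gmult G g h" "g \<in> U" "h \<in> V" "src G g = rng G h"
        by (auto simp: G_set_prod_def)
      moreover have "left_translate U k = h"
        using k Us Vs Ur
        by (subst left_translate_eq [of U g]) (auto simp: memP intro!: ginv_gmult_cancel)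
      ultimately show "k \<in> {k \<in> topspace (subtopology (arrows G) ?D). left_translate U k \<in> V}"
        by (auto simp: memP)
    qed
    finally show ?thesis .
  qed
  moreover have "compactin (arrows G) (G_set_prod U V)"
  proof -
    let ?I = "ginv G ` U"
    let ?D = "{k \<in> arrow_set G. rng G k \<in> rng G ` ?I}"
    have I: "openin (arrows G) ?I" "inj_on (rng G) ?I"
      using compact_open_G_set_ginv [OF U] by (auto simp: compact_open_G_set_def G_set_def)
    \<comment> \<open>The set \<open>?D\<close> of arrows whose range lies in this compact set is
      closed, so it cuts \<open>V\<close> in a compact set.\<close>
    have "compactin (arrows G) (src G ` U)"
      using Uc continuous_map_src by (rule image_compactin)
    then have "closedin (arrows G) ?D"
      by (intro closedin_continuous_map_preimage [OF continuous_map_rng])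
        (simp add: rng_image_ginv Us compactin_imp_closedin hausdorff)
    then have "compactin (subtopology (arrows G) ?D) (V \<inter> ?D)"
      using Vc by (simp add: compactin_subtopology compact_Int_closedin)
    then have "compactin (arrows G) (left_translate ?I ` (V \<inter> ?D))"
      using continuous_map_left_translate [OF I] by (rule image_compactin)
    also have "left_translate ?I ` (V \<inter> ?D) = G_set_prod U V"
    proof -
      \<comment> \<open>Translating by the inverse of \<open>U\<close> multiplies \<open>h\<close>
        by the arrow of \<open>U\<close> whose source is the range of \<open>h\<close>, as the two
        inversions cancel.\<close>
      have *: "left_translate ?I h = gmult G g h" if "g \<in> U" "src G g = rng G h" for g h
        using that Us I by (subst left_translate_eq [of ?I "ginv G g"]) (auto simp: rng_ginv ginv_ginv)
      have "V \<inter> ?D = {h \<in> V. \<exists>g\<in>U. src G g = rng G h}"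
        using Vs by (force simp: rng_image_ginv Us)
      then show ?thesis
        by (auto simp: G_set_prod_def image_iff) (metis *)+
    qed
    finally show ?thesis .
  qed
  ultimately show ?thesis
    by (auto simp: compact_open_G_set_def G_set_def)
qed

end

section \<open>Maps implemented by compact open G-sets\<close>

context etale_groupoid_compact_units
begin

text \<open>Clopen is meant in the space of arrows; since the unit space is itself clopen there,
  these are the clopen sets of \<open>unit_topology G\<close>.\<close>

definition clopen_units :: "'a set \<Rightarrow> bool" where
  "clopen_units E \<longleftrightarrow> E \<subseteq> unit_space G \<and> openin (arrows G) E \<and> closedin (arrows G) E"

text \<open>\<open>h\<close> restricted to \<open>E\<close> is the map \<open>\<pi>\<^sub>U\<close> of a compact open G-set \<open>U\<close> with \<open>s(U) = E\<close>; the
  values of \<open>h\<close> off \<open>E\<close> are irrelevant.\<close>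

definition G_map :: "('a \<Rightarrow> 'a) \<Rightarrow> 'a set \<Rightarrow> bool" where
  "G_map h E \<longleftrightarrow>
     (\<exists>U. compact_open_G_set G U \<and> src G ` U = E \<and> (\<forall>g\<in>U. rng G g = h (src G g)))"

lemma G_mapE:
  assumes "G_map h E"
  obtains U where "compact_open_G_set G U" "U \<subseteq> arrow_set G" "inj_on (src G) U" "inj_on (rng G) U"
    "src G ` U = E" "rng G ` U = h ` E" "\<And>g. g \<in> U \<Longrightarrow> rng G g = h (src G g)"
  using assms unfolding G_map_def compact_open_G_set_def G_set_def
  by (metis (no_types, lifting) image_cong image_image)

lemma clopen_units_space: "clopen_units (unit_space G)"
  by (simp add: clopen_units_def open_units compact_units compactin_imp_closedin hausdorff)

lemma clopen_units_empty: "clopen_units {}"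
  by (simp add: clopen_units_def)

lemma clopen_units_Un: "clopen_units E \<Longrightarrow> clopen_units F \<Longrightarrow> clopen_units (E \<union> F)"
  by (auto simp: clopen_units_def openin_Un closedin_Un)

lemma clopen_units_UN:
  "finite I \<Longrightarrow> (\<And>i. i \<in> I \<Longrightarrow> clopen_units (F i)) \<Longrightarrow> clopen_units (\<Union>i\<in>I. F i)"
  by (induction rule: finite_induct) (auto intro: clopen_units_Un clopen_units_empty)

lemma clopen_units_Diff: "clopen_units E \<Longrightarrow> clopen_units F \<Longrightarrow> clopen_units (E - F)"
  by (auto simp: clopen_units_def openin_diff closedin_diff)

text \<open>Source and range are open and continuous, so they send a compact open G-set to an open
  compact set, which is closed in a Hausdorff space.\<close>

lemma G_map_clopen:
  assumes "G_map h E"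
  shows "clopen_units E" "clopen_units (h ` E)"
proof -
  obtain U where U: "compact_open_G_set G U" "U \<subseteq> arrow_set G" "src G ` U = E" "rng G ` U = h ` E"
    using assms by (elim G_mapE) blast
  then have "openin (arrows G) U" "compactin (arrows G) U"
    by (auto simp: compact_open_G_set_def)
  then have "openin (arrows G) (src G ` U)" "openin (arrows G) (rng G ` U)"
      "closedin (arrows G) (src G ` U)" "closedin (arrows G) (rng G ` U)"
    using image_compactin [OF _ continuous_map_src] image_compactin [OF _ continuous_map_rng]
    by (simp_all add: openin_src_image openin_rng_image compactin_imp_closedin hausdorff)
  moreover have "src G ` U \<subseteq> unit_space G" "rng G ` U \<subseteq> unit_space G"
    using U(2) by (auto simp: src_in_unit_space rng_in_unit_space)
  ultimately show "clopen_units E" "clopen_units (h ` E)"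
    unfolding clopen_units_def U(3) U(4) by blast+
qed

lemma G_map_inj:
  assumes "G_map h E" shows "inj_on h E"
proof -
  obtain U where U: "inj_on (rng G) U" "src G ` U = E" "\<And>g. g \<in> U \<Longrightarrow> rng G g = h (src G g)"
    using assms by (elim G_mapE) blast
  then show ?thesis
    by (auto simp: inj_on_def)
qed

lemma G_map_cong: "(\<And>x. x \<in> E \<Longrightarrow> h x = k x) \<Longrightarrow> G_map h E \<longleftrightarrow> G_map k E"
  unfolding G_map_def by (metis imageI)

lemma G_map_id:
  assumes "clopen_units E" shows "G_map (\<lambda>x. x) E"
proof -
  have sub: "E \<subseteq> unit_space G" "openin (arrows G) E" "closedin (arrows G) E"
    using assms by (auto simp: clopen_units_def)
  have "compactin (arrows G) E"
    using closed_compactin [OF compact_units] sub by blast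
  moreover have "src G ` E = E" "inj_on (src G) E" "inj_on (rng G) E"
    using sub by (force simp: src_unit rng_unit inj_on_def subset_iff)+
  moreover have "\<forall>x\<in>E. rng G x = src G x"
    using sub by (auto simp: src_unit rng_unit)
  ultimately show ?thesis
    using sub unit_space_subset
    by (auto simp: G_map_def compact_open_G_set_def G_set_def intro!: exI [of _ E])
qed

text \<open>The product of the two G-sets implements the composite. By \<open>sub\<close>, every
  arrow of the G-set for \<open>h\<close> meets one of the G-set for \<open>k\<close>, so no source
  in \<open>E\<close> is lost.\<close>

lemma G_map_comp:
  assumes h: "G_map h E" and k: "G_map k F" and sub: "h ` E \<subseteq> F"
  shows "G_map (\<lambda>x. k (h x)) E"
proof -
  obtain U where U: "compact_open_G_set G U" "U \<subseteq> arrow_set G" "src G ` U = E"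
      "\<And>g. g \<in> U \<Longrightarrow> rng G g = h (src G g)"
    using h by (elim G_mapE) blast
  obtain V where V: "compact_open_G_set G V" "V \<subseteq> arrow_set G" "src G ` V = F"
      "\<And>g. g \<in> V \<Longrightarrow> rng G g = k (src G g)"
    using k by (elim G_mapE) blast
  have P: "src G (gmult G g f) = src G f" "rng G (gmult G g f) = k (h (src G f))"
    if "g \<in> V" "f \<in> U" "src G g = rng G f" for g f
    using that U V by (auto simp: src_gmult rng_gmult composable_def subset_iff)
  have "\<exists>g\<in>V. src G g = rng G f" if "f \<in> U" for f
  proof -
    have "rng G f \<in> src G ` V"
      using that U V sub by auto
    then show ?thesis by force
  qed
  then have "src G ` G_set_prod V U = E"
    using U(3) by (force simp: G_set_prod_def P image_iff)
  moreover have "\<forall>g\<in>G_set_prod V U. rng G g = k (h (src G g))"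
    by (auto simp: G_set_prod_def P)
  ultimately show ?thesis
    using compact_open_G_set_prod [OF V(1) U(1)] by (auto simp: G_map_def)
qed

lemma G_map_subset:
  assumes "G_map h E" "clopen_units F" "F \<subseteq> E"
  shows "G_map h F"
  using G_map_comp [OF G_map_id assms(1)] assms by simp

lemma G_map_inv_into:
  assumes "G_map h E" shows "G_map (inv_into E h) (h ` E)"
proof -
  obtain U where U: "compact_open_G_set G U" "U \<subseteq> arrow_set G" "src G ` U = E"
      "rng G ` U = h ` E" "\<And>g. g \<in> U \<Longrightarrow> rng G g = h (src G g)"
    using assms by (elim G_mapE) blast
  have "rng G (ginv G g) = inv_into E h (src G (ginv G g))" if "g \<in> U" for g
    using that U G_map_inj [OF assms] by (auto simp: rng_ginv src_ginv subset_iff)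
  moreover have "src G ` ginv G ` U = h ` E"
    using U(2,4) by (simp add: src_image_ginv)
  ultimately show ?thesis
    unfolding G_map_def using compact_open_G_set_ginv [OF U(1)] by blast
qed

text \<open>The union of the two G-sets works: disjointness of \<open>E\<close> and \<open>F\<close>
  makes the source injective on it, and injectivity of \<open>h\<close> on the union does the same
  for the range.\<close>

lemma G_map_Un:
  assumes h: "G_map h E" "G_map h F" and "E \<inter> F = {}" and inj: "inj_on h (E \<union> F)"
  shows "G_map h (E \<union> F)"
proof -
  obtain U where U: "compact_open_G_set G U" "inj_on (src G) U" "src G ` U = E"
      "\<And>g. g \<in> U \<Longrightarrow> rng G g = h (src G g)"
    using h by (elim G_mapE) blast
  obtain V where V: "compact_open_G_set G V" "inj_on (src G) V" "src G ` V = F"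
      "\<And>g. g \<in> V \<Longrightarrow> rng G g = h (src G g)"
    using h by (elim G_mapE) blast
  have src: "inj_on (src G) (U \<union> V)"
    using U V \<open>E \<inter> F = {}\<close> by (auto simp: inj_on_Un)
  have "inj_on (h \<circ> src G) (U \<union> V)"
    using U V inj src by (intro comp_inj_on) (auto simp: image_Un)
  then have "inj_on (rng G) (U \<union> V)"
    by (rule inj_on_cong [THEN iffD1, rotated]) (use U V in auto)
  then have "compact_open_G_set G (U \<union> V)"
    using U V src by (auto simp: compact_open_G_set_def G_set_def compactin_Un openin_Un)
  then show ?thesis
    using U V by (auto simp: G_map_def image_Un intro!: exI [of _ "U \<union> V"])
qed

lemma G_map_UN:
  assumes "finite I" "\<And>i. i \<in> I \<Longrightarrow> G_map h (F i)" "disjoint_family_on F I"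
    and "inj_on h (\<Union>i\<in>I. F i)"
  shows "G_map h (\<Union>i\<in>I. F i)"
  using assms
proof (induction rule: finite_induct)
  case empty
  then show ?case
    using G_map_id [OF clopen_units_empty] G_map_cong [of "{}" h "\<lambda>x. x"] by simp
next
  case (insert i I)
  have "G_map h (F i \<union> (\<Union>i\<in>I. F i))"
    using insert by (intro G_map_Un insert.IH)
      (auto simp: disjoint_family_on_def disjoint_iff inj_on_Un intro: inj_on_subset)
  then show ?case by simp
qed

text \<open>On the G-set, \<open>h\<close> after the source map is the range map. The source map is
  a continuous bijection from a compact set onto a Hausdorff space, hence a homeomorphism through
  which continuity descends to \<open>h\<close>.\<close>

lemma G_map_continuous:
  assumes h: "G_map h (unit_space G)" and sub: "h ` unit_space G \<subseteq> unit_space G"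
  shows "continuous_map (unit_topology G) (unit_topology G) h"
proof -
  obtain U where U: "compact_open_G_set G U" "U \<subseteq> arrow_set G" "inj_on (src G) U"
      "src G ` U = unit_space G" "\<And>g. g \<in> U \<Longrightarrow> rng G g = h (src G g)"
    using h by (elim G_mapE) blast
  have cont: "continuous_map (subtopology (arrows G) U) (unit_topology G) (src G)"
      "continuous_map (subtopology (arrows G) U) (unit_topology G) (rng G)"
    using U(2) unfolding unit_topology_def
    by (auto intro!: continuous_map_into_subtopology continuous_map_from_subtopology
        continuous_map_src continuous_map_rng simp: src_in_unit_space rng_in_unit_space)
  have "homeomorphic_map (subtopology (arrows G) U) (unit_topology G) (src G)"
    using U unit_space_subset
    by (intro continuous_imp_homeomorphic_map cont)
      (auto simp: compact_open_G_set_def compact_space_subtopology unit_topology_def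
        Hausdorff_space_subtopology hausdorff Int_absorb1)
  moreover have "continuous_map (subtopology (arrows G) U) (unit_topology G) (h \<circ> src G)"
    using cont(2) by (rule continuous_map_eq) (auto simp: U)
  ultimately show ?thesis
    using continuous_compose_quotient_map homeomorphic_map_def by blast
qed

section \<open>The topological full group as a group of permutations of the units\<close>

lemma topspace_unit_topology: "topspace (unit_topology G) = unit_space G"
  using unit_space_subset by (auto simp: unit_topology_def)

text \<open>Reduces membership to \<open>G_map\<close> and surjectivity. Injectivity comes from the
  G-set, and a continuous bijection of a compact Hausdorff space is a homeomorphism.\<close>

lemma topological_full_group_carrier:
  "carrier (topological_full_group G) =
     {\<alpha> \<in> extensional (unit_space G). G_map \<alpha> (unit_space G) \<and> \<alpha> ` unit_space G = unit_space G}"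
proof (intro equalityI subsetI)
  fix \<alpha> assume "\<alpha> \<in> carrier (topological_full_group G)"
  then obtain U where \<alpha>: "\<alpha> \<in> Bij (unit_space G)" "\<alpha> = G_set_map G U"
      and U: "compact_open_G_set G U" "src G ` U = unit_space G"
    by (auto simp: topological_full_group_def)
  have "\<forall>g\<in>U. rng G g = \<alpha> (src G g)"
    using U \<alpha>(2)
    by (auto simp: G_set_map_def compact_open_G_set_def G_set_def the_inv_into_f_f)
  then have "G_map \<alpha> (unit_space G)"
    using U by (auto simp: G_map_def)
  then show "\<alpha> \<in> {\<alpha> \<in> extensional (unit_space G).
      G_map \<alpha> (unit_space G) \<and> \<alpha> ` unit_space G = unit_space G}"
    using \<alpha> by (auto simp: Bij_def bij_betw_def)
next
  fix \<alpha> assume "\<alpha> \<in> {\<alpha> \<in> extensional (unit_space G).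
      G_map \<alpha> (unit_space G) \<and> \<alpha> ` unit_space G = unit_space G}"
  then have \<alpha>: "\<alpha> \<in> extensional (unit_space G)" "G_map \<alpha> (unit_space G)"
      "\<alpha> ` unit_space G = unit_space G"
    by auto
  obtain U where U: "compact_open_G_set G U" "inj_on (src G) U"
      "src G ` U = unit_space G" "rng G ` U = \<alpha> ` unit_space G"
      "\<And>g. g \<in> U \<Longrightarrow> rng G g = \<alpha> (src G g)"
    using \<alpha>(2) by (elim G_mapE) blast
  have bij: "inj_on \<alpha> (unit_space G)"
    using \<alpha>(2) by (rule G_map_inj)
  have "homeomorphic_map (unit_topology G) (unit_topology G) \<alpha>"
    using \<alpha> bij compact_units hausdorff G_map_continuous
    by (intro continuous_imp_homeomorphic_map)
      (auto simp: topspace_unit_topology, simp_all add: unit_topology_def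
        compact_space_subtopology Hausdorff_space_subtopology)
  moreover have "\<alpha> = G_set_map G U"
  proof (rule extensionalityI [OF \<alpha>(1)])
    show "G_set_map G U \<in> extensional (unit_space G)"
      by (simp add: G_set_map_def U(3))
    fix x assume "x \<in> unit_space G"
    then obtain g where "g \<in> U" "x = src G g"
      using U(3) by blast
    then show "\<alpha> x = G_set_map G U x"
      using U(2,5) by (simp add: G_set_map_def the_inv_into_f_f)
  qed
  moreover have "\<alpha> \<in> Bij (unit_space G)" "rng G ` U = unit_space G"
    using \<alpha> bij U(4) by (simp_all add: Bij_def bij_betw_def)
  ultimately show "\<alpha> \<in> carrier (topological_full_group G)"
    using U(1,3) unfolding topological_full_group_def by auto
qed

lemma subgroup_topological_full_group:
  "subgroup (carrier (topological_full_group G)) (BijGroup (unit_space G))"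
proof (rule subgroup.intro)
  show sub: "carrier (topological_full_group G) \<subseteq> carrier (BijGroup (unit_space G))"
    by (auto simp: topological_full_group_carrier BijGroup_def Bij_def bij_betw_def G_map_inj)
  show "\<one>\<^bsub>BijGroup (unit_space G)\<^esub> \<in> carrier (topological_full_group G)"
    using G_map_id [OF clopen_units_space]
      G_map_cong [of "unit_space G" "\<lambda>x\<in>unit_space G. x" "\<lambda>x. x"]
    by (simp add: topological_full_group_carrier BijGroup_def)
  fix \<alpha> assume \<alpha>: "\<alpha> \<in> carrier (topological_full_group G)"
  then have \<alpha>': "\<alpha> \<in> Bij (unit_space G)" "G_map \<alpha> (unit_space G)" "\<alpha> ` unit_space G = unit_space G"
    using sub by (auto simp: topological_full_group_carrier BijGroup_def)
  have "G_map (inv_into (unit_space G) \<alpha>) (unit_space G)"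
    using G_map_inv_into [OF \<alpha>'(2)] \<alpha>'(3) by simp
  moreover have "inv_into (unit_space G) \<alpha> ` unit_space G = unit_space G"
    using \<alpha>'(1) by (auto simp: Bij_def intro!: bij_betw_imp_surj_on bij_betw_inv_into)
  ultimately show "inv\<^bsub>BijGroup (unit_space G)\<^esub> \<alpha> \<in> carrier (topological_full_group G)"
    using \<alpha>' by (simp add: topological_full_group_carrier inv_BijGroup cong: G_map_cong)
  fix \<beta> assume \<beta>: "\<beta> \<in> carrier (topological_full_group G)"
  then have \<beta>': "\<beta> \<in> Bij (unit_space G)" "G_map \<beta> (unit_space G)" "\<beta> ` unit_space G = unit_space G"
    using sub by (auto simp: topological_full_group_carrier BijGroup_def)
  have "G_map (compose (unit_space G) \<alpha> \<beta>) (unit_space G)"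
    using G_map_comp [OF \<beta>'(2) \<alpha>'(2)] \<beta>'(3) by (simp add: compose_def cong: G_map_cong)
  moreover have "compose (unit_space G) \<alpha> \<beta> ` unit_space G = unit_space G"
    using \<alpha>'(3) \<beta>'(3) by (rule surj_compose [rotated])
  ultimately show "\<alpha> \<otimes>\<^bsub>BijGroup (unit_space G)\<^esub> \<beta> \<in> carrier (topological_full_group G)"
    using \<alpha>' \<beta>' by (simp add: topological_full_group_carrier BijGroup_def compose_def)
qed

lemma group_topological_full_group: "group (topological_full_group G)"
proof -
  have "(BijGroup (unit_space G))\<lparr>carrier := carrier (topological_full_group G)\<rparr>
      = topological_full_group G"
    by (simp add: topological_full_group_def)
  then show ?thesis
    using subgroup.subgroup_is_group [OF subgroup_topological_full_group group_BijGroup]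
    by (simp only:)
qed

lemma topological_full_group_mult:
  assumes "\<alpha> \<in> carrier (topological_full_group G)" "\<beta> \<in> carrier (topological_full_group G)"
  shows "\<alpha> \<otimes>\<^bsub>topological_full_group G\<^esub> \<beta> = compose (unit_space G) \<alpha> \<beta>"
proof -
  \<comment> \<open>Multiplication in \<open>BijGroup\<close> is restricted to bijections, so it
    unfolds to \<open>compose\<close> only once both factors are known to be such.\<close>
  have "\<alpha> \<in> Bij (unit_space G)" "\<beta> \<in> Bij (unit_space G)"
    using assms subgroup.subset [OF subgroup_topological_full_group] by (auto simp: BijGroup_def)
  then show ?thesis
    by (simp add: topological_full_group_def BijGroup_def)
qed

lemma group_action_topological_full_group:
  "group_action (topological_full_group G) (unit_space G) (\<lambda>\<alpha>. \<alpha>)"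
proof -
  have "(\<lambda>\<alpha>. \<alpha>) \<in> hom (topological_full_group G) (BijGroup (unit_space G))"
    using subgroup.subset [OF subgroup_topological_full_group]
    by (auto simp: hom_def topological_full_group_def)
  then show ?thesis
    by (simp add: group_action_def group_hom_def group_hom_axioms_def group_BijGroup
        group_topological_full_group)
qed

end

section \<open>Cyclic permutations of disjoint copies of a clopen set\<close>

text \<open>\<open>rotation n e E k\<close> sends \<open>e i y\<close> to \<open>e ((i + k) mod n) y\<close> for \<open>y \<in> E\<close>, cyclically permuting the
  copies \<open>e 0 ` E, \<dots>, e (n - 1) ` E\<close> of \<open>E\<close>, and is the identity elsewhere.\<close>

definition rotation :: "int \<Rightarrow> (int \<Rightarrow> 'x \<Rightarrow> 'x) \<Rightarrow> 'x set \<Rightarrow> int \<Rightarrow> 'x \<Rightarrow> 'x" where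
  "rotation n e E k x =
     (if x \<in> (\<lambda>(i, y). e i y) ` ({0..<n} \<times> E)
      then case inv_into ({0..<n} \<times> E) (\<lambda>(i, y). e i y) x of (i, y) \<Rightarrow> e ((i + k) mod n) y
      else x)"

text \<open>The injectivity assumption says both that each \<open>e i\<close> is injective on
  \<open>E\<close> and that the copies are disjoint; so a point of a copy determines
  \<open>i\<close> and \<open>y\<close>.\<close>

lemma rotation_piece:
  assumes "inj_on (\<lambda>(i, y). e i y) ({0..<n} \<times> E)" "i \<in> {0..<n}" "y \<in> E"
  shows "rotation n e E k (e i y) = e ((i + k) mod n) y"
proof -
  have "inv_into ({0..<n} \<times> E) (\<lambda>(i, y). e i y) (e i y) = (i, y)"
    using inv_into_f_f [OF assms(1), of "(i, y)"] assms by simp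
  moreover have "e i y \<in> (\<lambda>(i, y). e i y) ` ({0..<n} \<times> E)"
    using assms by force
  ultimately show ?thesis
    by (simp add: rotation_def)
qed

lemma rotation_outside:
  "x \<notin> (\<Union>i\<in>{0..<n}. e i ` E) \<Longrightarrow> rotation n e E k x = x"
  by (force simp: rotation_def)

text \<open>Indices of copies add modulo \<open>n\<close>. The sum is reduced so as to match the
  multiplication of \<open>integer_mod_group\<close>.\<close>

lemma rotation_rotation:
  assumes "inj_on (\<lambda>(i, y). e i y) ({0..<n} \<times> E)" "n > 0"
  shows "rotation n e E k (rotation n e E l x) = rotation n e E ((k + l) mod n) x"
proof (cases "x \<in> (\<Union>i\<in>{0..<n}. e i ` E)")
  case True
  then obtain i y where "i \<in> {0..<n}" "y \<in> E" "x = e i y"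
    by auto
  moreover have "((i + l) mod n + k) mod n = (i + (k + l) mod n) mod n" for i
    by (simp add: mod_simps ac_simps)
  ultimately show ?thesis
    using assms by (simp add: rotation_piece)
qed (simp add: rotation_outside)

lemma rotation_zero:
  assumes "inj_on (\<lambda>(i, y). e i y) ({0..<n} \<times> E)"
  shows "rotation n e E 0 x = x"
proof (cases "x \<in> (\<Union>i\<in>{0..<n}. e i ` E)")
  case True
  then show ?thesis
    using assms by (auto simp: rotation_piece)
qed (simp add: rotation_outside)

context etale_groupoid_compact_units
begin

text \<open>On copy \<open>i\<close> the rotation is the inverse of \<open>e i\<close> followed by
  another of the embeddings, off the copies it is the identity, and these finitely many pieces glue
  because the whole map is injective.\<close>

lemma rotation_in_topological_full_group:
  assumes inj: "inj_on (\<lambda>(i, y). e i y) ({0..<n} \<times> E)" and n: "n > 0"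
    and e: "\<And>i. i \<in> {0..<n} \<Longrightarrow> G_map (e i) E"
  shows "restrict (rotation n e E k) (unit_space G) \<in> carrier (topological_full_group G)"
proof -
  let ?X = "unit_space G" and ?P = "\<Union>i\<in>{0..<n}. e i ` E"
  \<comment> \<open>Rotation by \<open>- k\<close> is a two-sided inverse; it gives injectivity here
    and surjectivity at the end.\<close>
  have cancel: "rotation n e E (- k) (rotation n e E k x) = x"
      "rotation n e E k (rotation n e E (- k) x) = x" for k x
    by (simp_all add: rotation_rotation [OF inj n] rotation_zero [OF inj])
  have rot_inj: "inj_on (rotation n e E k) S" for S
    by (metis cancel(1) inj_on_inverseI)
  have piece: "clopen_units (e i ` E)" if "i \<in> {0..<n}" for i
    using G_map_clopen e that by blast
  have P: "clopen_units ?P"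
    using piece by (intro clopen_units_UN) auto
  have "G_map (rotation n e E k) (e i ` E)" if i: "i \<in> {0..<n}" for i
  proof -
    have "G_map (\<lambda>x. e ((i + k) mod n) (inv_into E (e i) x)) (e i ` E)"
      using n i G_map_inj [OF e [OF i]]
      by (intro G_map_comp [OF G_map_inv_into [OF e [OF i]] e]) (auto simp: inv_into_f_f)
    then show ?thesis
      using G_map_inj [OF e [OF i]] i
      by (subst G_map_cong [where k = "\<lambda>x. e ((i + k) mod n) (inv_into E (e i) x)"])
        (auto simp: rotation_piece [OF inj])
  qed
  moreover have "disjoint_family_on (\<lambda>i. e i ` E) {0..<n}"
    using inj by (force simp: disjoint_family_on_def inj_on_def)
  ultimately have "G_map (rotation n e E k) ?P"
    using rot_inj by (intro G_map_UN) auto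
  moreover have "G_map (rotation n e E k) (?X - ?P)"
    using G_map_id [OF clopen_units_Diff [OF clopen_units_space P]]
    by (subst G_map_cong [where k = "\<lambda>x. x"]) (auto simp: rotation_outside)
  ultimately have "G_map (rotation n e E k) (?P \<union> (?X - ?P))"
    using rot_inj by (intro G_map_Un) auto
  moreover have PX: "?P \<union> (?X - ?P) = ?X"
    using P by (auto simp: clopen_units_def)
  ultimately have "G_map (restrict (rotation n e E k) ?X) ?X"
    by (simp only:) (simp cong: G_map_cong)
  have sub: "rotation n e E k ` ?X \<subseteq> ?X" for k
  proof -
    have "rotation n e E k x \<in> ?X" if "x \<in> ?X" for x
    proof (cases "x \<in> ?P")
      case True
      then obtain i y where "i \<in> {0..<n}" "y \<in> E" "x = e i y"
        by auto
      then have "rotation n e E k x \<in> ?P"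
        using n by (auto simp: rotation_piece [OF inj] intro!: bexI [of _ "(i + k) mod n"])
      then show ?thesis using PX by blast
    qed (use that in \<open>simp add: rotation_outside\<close>)
    then show ?thesis by blast
  qed
  have "?X \<subseteq> rotation n e E k ` ?X"
  proof
    fix x assume "x \<in> ?X"
    then have "rotation n e E (- k) x \<in> ?X" using sub by blast
    then show "x \<in> rotation n e E k ` ?X" by (metis cancel(2) imageI)
  qed
  with sub have "rotation n e E k ` ?X = ?X"
    by (rule subset_antisym)
  with \<open>G_map (restrict (rotation n e E k) ?X) ?X\<close> show ?thesis
    by (simp add: topological_full_group_carrier)
qed

lemma rotation_hom:
  assumes inj: "inj_on (\<lambda>(i, y). e i y) ({0..<int n} \<times> E)" and n: "n > 0"
    and e: "\<And>i. i \<in> {0..<int n} \<Longrightarrow> G_map (e i) E"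
  shows "(\<lambda>k. restrict (rotation (int n) e E k) (unit_space G))
    \<in> hom (integer_mod_group n) (topological_full_group G)"
proof (rule homI)
  let ?r = "\<lambda>k. restrict (rotation (int n) e E k) (unit_space G)"
  have n': "int n > 0" using n by simp
  show mem: "?r k \<in> carrier (topological_full_group G)" for k
    by (rule rotation_in_topological_full_group [OF inj n' e])
  fix k l
  \<comment> \<open>The inner map stays in the unit space, so restricting the outer one does not
    disturb the composite.\<close>
  have "?r l ` unit_space G = unit_space G"
    using mem [of l] unfolding topological_full_group_carrier by blast
  then show "?r (k \<otimes>\<^bsub>integer_mod_group n\<^esub> l) = ?r k \<otimes>\<^bsub>topological_full_group G\<^esub> ?r l"
    by (auto simp: topological_full_group_mult [OF mem mem] compose_def fun_eq_iff
        rotation_rotation [OF inj n'])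
qed

end

section \<open>From the hypotheses on the groupoid to the theorem\<close>

lemma (in etale_groupoid) compact_units_if_essentially_principal:
  assumes "essentially_principal G" "cantor_space (unit_topology G)"
  shows "etale_groupoid_compact_units G"
proof
  \<comment> \<open>Essential principality presents the unit space as an interior.\<close>
  show "openin (arrows G) (unit_space G)"
    using assms(1) by (metis essentially_principal_def openin_interior_of)
  show "compactin (arrows G) (unit_space G)"
    using assms(2) unit_space_subset
    by (auto simp: cantor_space_def unit_topology_def compactin_subspace)
qed

lemma (in etale_groupoid_compact_units) properly_infiniteE:
  assumes "properly_infinite G (unit_space G)"
  obtains u v where "G_map u (unit_space G)" "G_map v (unit_space G)"
    "u ` unit_space G \<subseteq> unit_space G" "v ` unit_space G \<subseteq> unit_space G"
    "u ` unit_space G \<inter> v ` unit_space G = {}"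
proof -
  let ?X = "unit_space G"
  obtain U V where U: "compact_open_G_set G U" "src G ` U = ?X"
      and V: "compact_open_G_set G V" "src G ` V = ?X"
      and r: "rng G ` U \<union> rng G ` V \<subseteq> ?X" "rng G ` U \<inter> rng G ` V = {}"
    using assms by (auto simp: properly_infinite_def)
  have *: "\<forall>g\<in>W. rng G g = rng G (the_inv_into W (src G) (src G g))"
    if "compact_open_G_set G W" for W
    using that by (auto simp: compact_open_G_set_def G_set_def the_inv_into_f_f)
  define u v where "u = (\<lambda>x. rng G (the_inv_into U (src G) x))"
    and "v = (\<lambda>x. rng G (the_inv_into V (src G) x))"
  have "u ` src G ` U = rng G ` U" "v ` src G ` V = rng G ` V"
    unfolding u_def v_def image_image using * [OF U(1)] * [OF V(1)] by (auto intro!: image_cong)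
  moreover have "G_map u ?X" "G_map v ?X"
    unfolding u_def v_def G_map_def using U V * by blast+
  ultimately show thesis
    using that U V r by (metis le_sup_iff)
qed

theorem proposition4p10:
  fixes G :: "('a, 'm) groupoid_data_scheme"
  assumes "etale_groupoid G"
    and "essentially_principal G"
    and "cantor_space (unit_topology G)"
    and "properly_infinite G (unit_space G)"
  shows "(\<exists>H. subgroup H (topological_full_group G) \<and>
            (topological_full_group G)\<lparr>carrier := H\<rparr> \<cong>
              free_product (integer_mod_group 2) (integer_mod_group 3)) \<and>
         \<not> amenable_group (topological_full_group G)"
proof -
  interpret etale_groupoid_compact_units G
    using assms(1-3) by (rule etale_groupoid.compact_units_if_essentially_principal)
  let ?X = "unit_space G" and ?T = "topological_full_group G"
  obtain u v where u: "G_map u ?X" and v: "G_map v ?X"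
      and sub: "u ` ?X \<subseteq> ?X" "v ` ?X \<subseteq> ?X" and disj: "u ` ?X \<inter> v ` ?X = {}"
    using assms(4) by (rule properly_infiniteE)
  have u_inj: "u x = u y \<longleftrightarrow> x = y" and v_inj: "v x = v y \<longleftrightarrow> x = y"
      and uv: "u x \<noteq> v y" "v x \<noteq> u y" and uX: "u x \<in> ?X" and vX: "v x \<in> ?X"
    if "x \<in> ?X" "y \<in> ?X" for x y
    using that u v sub disj by (auto dest: G_map_inj inj_onD)
  define A where "A = u ` ?X"
  define B where "B = (\<lambda>x. v (u x)) ` ?X"
  \<comment> \<open>Embeddings for \<open>rotation\<close>: of \<open>?X - B\<close> as itself and
    as a copy inside \<open>B\<close>, and of \<open>?X - A\<close> as itself and as two copies
    inside \<open>A\<close>. Index 0 is the identity in both families, so rotation by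
    \<open>k\<close> acts on the original set as the embedding with index \<open>k\<close>.\<close>
  define e2 where "e2 i = (if i = 0 then (\<lambda>x. x) else (\<lambda>x. v (u x)))" for i :: int
  define e3 where "e3 i = (if i = 0 then (\<lambda>x. x) else if i = 1 then (\<lambda>x. u (u x)) else (\<lambda>x. u (v x)))"
    for i :: int
  have vu: "G_map (\<lambda>x. v (u x)) ?X" and uu: "G_map (\<lambda>x. u (u x)) ?X" and uv': "G_map (\<lambda>x. u (v x)) ?X"
    using u v sub by (auto intro: G_map_comp)
  have AB: "A \<subseteq> ?X" "B \<subseteq> ?X" "A \<inter> B = {}"
    using uX vX uv by (auto simp: A_def B_def)
  have clopen: "clopen_units (?X - A)" "clopen_units (?X - B)"
    unfolding A_def B_def using u vu by (auto intro: clopen_units_Diff clopen_units_space G_map_clopen)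
  obtain x where "x \<in> ?X"
    using assms(3) by (auto simp: cantor_space_def topspace_unit_topology)
  \<comment> \<open>The point is outside \<open>A\<close> because the images of \<open>u\<close> and
    \<open>v\<close> are disjoint, and outside \<open>B\<close> because cancelling the outer
    \<open>v\<close> would again give a common value of \<open>u\<close> and
    \<open>v\<close>.\<close>
  then have p: "v (v x) \<in> ?X - (A \<union> B)"
    using uX vX uv v_inj by (auto simp: A_def B_def)
  \<comment> \<open>The nonidentity copies lie in \<open>B\<close> and in \<open>A\<close>
    respectively, away from the original sets; the two copies inside \<open>A\<close> are disjoint
    because \<open>u\<close> is injective and the images of \<open>u\<close> and \<open>v\<close>
    are disjoint.\<close>
  have inj2: "inj_on (\<lambda>(i, y). e2 i y) ({0..<int 2} \<times> (?X - B))"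
    using u_inj v_inj uX by (auto simp: inj_on_def e2_def B_def)
  have inj3: "inj_on (\<lambda>(i, y). e3 i y) ({0..<int 3} \<times> (?X - A))"
    using u_inj v_inj uX vX uv by (auto simp: inj_on_def e3_def A_def)
  have e2: "G_map (e2 i) (?X - B)" and e3: "G_map (e3 i) (?X - A)" for i
    using clopen vu uu uv' G_map_id [OF clopen_units_space]
    by (auto simp: e2_def e3_def intro: G_map_subset)
  define f where "f k = restrict (rotation (int 2) e2 (?X - B) k) ?X" for k
  define g where "g k = restrict (rotation (int 3) e3 (?X - A) k) ?X" for k
  interpret free_product_homs "integer_mod_group 2" "integer_mod_group 3" ?T f g
  proof (intro free_product_homs.intro free_product_homs_axioms.intro)
    show "f \<in> hom (integer_mod_group 2) ?T"
      unfolding f_def [abs_def] using e2 by (intro rotation_hom [OF inj2]) simp_all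
    show "g \<in> hom (integer_mod_group 3) ?T"
      unfolding g_def [abs_def] using e3 by (intro rotation_hom [OF inj3]) simp_all
  qed (simp_all add: group_topological_full_group)
  interpret action: group_action ?T ?X "\<lambda>\<alpha>. \<alpha>"
    by (rule group_action_topological_full_group)
  have e_0: "e2 0 y = y" "e3 0 y = y" for y
    by (simp_all add: e2_def e3_def)
  have f_eq: "f k y = e2 k y" if "k \<in> {0..<int 2}" "y \<in> ?X - B" for k y
    using that rotation_piece [OF inj2, of 0 y k] by (simp add: f_def e_0)
  have g_eq: "g k y = e3 k y" if "k \<in> {0..<int 3}" "y \<in> ?X - A" for k y
    using that rotation_piece [OF inj3, of 0 y k] by (simp add: g_def e_0)
  have fB: "f k ` (?X - B) \<subseteq> B" if "k \<in> carrier (integer_mod_group 2) - {\<one>\<^bsub>integer_mod_group 2\<^esub>}" for k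
    using that by (auto simp: f_eq e2_def B_def carrier_integer_mod_group)
  have gA: "g k ` (?X - A) \<subseteq> A" if "k \<in> carrier (integer_mod_group 3) - {\<one>\<^bsub>integer_mod_group 3\<^esub>}" for k
    using that uX vX by (auto simp: g_eq e3_def A_def carrier_integer_mod_group)
  have "inj_on (free_product_lift ?T f g)
      (carrier (free_product (integer_mod_group 2) (integer_mod_group 3)))"
    using AB p fB gA by (rule lift_ping_pong_inj [OF action.group_action_axioms])
  then have "\<exists>H. subgroup H ?T \<and> ?T\<lparr>carrier := H\<rparr> \<cong>
      free_product (integer_mod_group 2) (integer_mod_group 3)"
    by (rule ex_subgroup_iso_free_product)
  \<comment> \<open>Non-amenability is read off the same sets \<open>A\<close> and \<open>B\<close>
    through the action, not from the subgroup. The orbit map may start at any unit, here at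
    \<open>x\<close>.\<close>
  moreover have "\<not> amenable_group ?T"
  proof (rule action.not_amenable_if_paradoxical_action)
    show "x \<in> ?X" "A \<inter> B = {}" by fact+
    show "f 1 \<in> carrier ?T" "g 1 \<in> carrier ?T" "g 2 \<in> carrier ?T"
      by (simp_all add: hom_in_carrier [OF f] hom_in_carrier [OF g] carrier_integer_mod_group)
    show "f 1 ` (?X - B) \<subseteq> B" "g 1 ` (?X - A) \<subseteq> A" "g 2 ` (?X - A) \<subseteq> A"
      by (rule fB gA, simp add: carrier_integer_mod_group)+
    show "g 1 ` (?X - A) \<inter> g 2 ` (?X - A) = {}"
      using u_inj uX vX uv by (auto simp: g_eq e3_def)
  qed
  ultimately show ?thesis ..
qed

end
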